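(* There exist a quandle $X$ and a connected component $O \subset X$ which satisfy the following properties: (1) The groups $\mathrm{Inn}(X)$ and $\mathrm{Dis}(X)$ are finitely generated. (2) For any finite generating set $A$ of $\mathrm{Inn}(X)$ and any finite generating set $U$ of $\mathrm{Dis}(X)$, the metric spaces $(O, d^{\mathrm{Inn}}_A)$ and $(O, d^{\mathrm{Dis}}_{U})$ are not quasi-isometric.
   Context: A quandle is a non-empty set $X$ with a binary operation $\triangleleft$ such that (i) $x \triangleleft x = x$ for all $x$; (ii) for every $y \in X$ the map $s_y \colon X \to X$, $s_y(x) = x \triangleleft y$, is a bijection (the point symmetry at $y$); (iii) $(x \triangleleft y)\triangleleft z = (x \triangleleft z)\triangleleft (y \triangleleft z)$ for all $x,y,z$. $\mathrm{Aut}(X)$ is the group of bijective quandle homomorphisms $X\to X$ with product $fg := g \circ f$; it acts on $X$ from the right by $x\cdot f := f(x)$. $\mathrm{Inn}(X)$ is the subgroup of $\mathrm{Aut}(X)$ generated by $\{s_y \mid y \in X\}$, and $\mathrm{Dis}(X)$ is the subgroup generated by $\{s_x s_y^{-1} \mid x,y\in X\}$. A connected component of $X$ is an orbit of $\mathrm{Inn}(X)$; the orbits of $\mathrm{Dis}(X)$ on $X$ are the same sets. For a group $G$ acting on $X$ from the right and a generating set $S$ of $G$, the Schreier graph $\Gamma(X,G,S)$ is the undirected graph with vertex set $X$ in which $x,y$ are joined by an edge if $y = x\cdot s$ for some $s \in S\cup S^{-1}$. Its connected components are the $G$-orbits, and each carries the path metric (edges have length one). For a generating set $A$ of $\mathrm{Inn}(X)$,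 the inner metric $d^{\mathrm{Inn}}_A$ on a connected component is the path metric of $\Gamma(X,\mathrm{Inn}(X),A)$; for a generating set $U$ of $\mathrm{Dis}(X)$, the displacement metric $d^{\mathrm{Dis}}_U$ is the path metric of $\Gamma(X,\mathrm{Dis}(X),U)$. *)

theory Defs
  imports Complex_Main "HOL-Algebra.Bij" "HOL-Algebra.Group_Action"
    "HOL-Algebra.Elementary_Groups"
begin

locale quandle =
  fixes X :: "'a set" and tri :: "'a \<Rightarrow> 'a \<Rightarrow> 'a" (infixl "\<triangleleft>" 70)
  assumes nonempty: "X \<noteq> {}"
    and closed: "\<lbrakk>x \<in> X; y \<in> X\<rbrakk> \<Longrightarrow> x \<triangleleft> y \<in> X"
    and idem: "x \<in> X \<Longrightarrow> x \<triangleleft> x = x"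
    and bij: "y \<in> X \<Longrightarrow> bij_betw (\<lambda>x. x \<triangleleft> y) X X"
    and self_distrib: "\<lbrakk>x \<in> X; y \<in> X; z \<in> X\<rbrakk> \<Longrightarrow> (x \<triangleleft> y) \<triangleleft> z = (x \<triangleleft> z) \<triangleleft> (y \<triangleleft> z)"

(* Self-maps of X are represented by extensional functions, as in HOL-Algebra.Bij, so that
   equality of group elements is equality of maps on X. *)
definition point_sym :: "'a set \<Rightarrow> ('a \<Rightarrow> 'a \<Rightarrow> 'a) \<Rightarrow> 'a \<Rightarrow> ('a \<Rightarrow> 'a)" where
  "point_sym X tri y = (\<lambda>x\<in>X. tri x y)"

(* The product is f g := g o f, i.e. opposite to that of BijGroup, so that x . f := f x
   is a right action. *)
definition quandle_Aut :: "'a set \<Rightarrow> ('a \<Rightarrow> 'a \<Rightarrow> 'a) \<Rightarrow> ('a \<Rightarrow> 'a) monoid" where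
  "quandle_Aut X tri =
    \<lparr>carrier = {f \<in> Bij X. \<forall>x\<in>X. \<forall>y\<in>X. f (tri x y) = tri (f x) (f y)},
     mult = (\<lambda>f g. compose X g f),
     one = (\<lambda>x\<in>X. x)\<rparr>"

definition quandle_Inn :: "'a set \<Rightarrow> ('a \<Rightarrow> 'a \<Rightarrow> 'a) \<Rightarrow> ('a \<Rightarrow> 'a) monoid" where
  "quandle_Inn X tri = subgroup_generated (quandle_Aut X tri) (point_sym X tri ` X)"

definition quandle_Dis :: "'a set \<Rightarrow> ('a \<Rightarrow> 'a \<Rightarrow> 'a) \<Rightarrow> ('a \<Rightarrow> 'a) monoid" where
  "quandle_Dis X tri = subgroup_generated (quandle_Aut X tri)
    {point_sym X tri x \<otimes>\<^bsub>quandle_Aut X tri\<^esub> inv\<^bsub>quandle_Aut X tri\<^esub> (point_sym X tri y)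
      | x y. x \<in> X \<and> y \<in> X}"

definition quandle_components :: "'a set \<Rightarrow> ('a \<Rightarrow> 'a \<Rightarrow> 'a) \<Rightarrow> 'a set set" where
  "quandle_components X tri = orbits (quandle_Inn X tri) X (\<lambda>f. f)"

definition generates_group :: "('g, 'm) monoid_scheme \<Rightarrow> 'g set \<Rightarrow> bool" where
  "generates_group G S \<longleftrightarrow> S \<subseteq> carrier G \<and> generate G S = carrier G"

definition finitely_generated_group :: "('g, 'm) monoid_scheme \<Rightarrow> bool" where
  "finitely_generated_group G \<longleftrightarrow> (\<exists>S. finite S \<and> generates_group G S)"

(* Adjacency relation; it is symmetric when act is a right action of the group G on X,
   because inverses of S are included. *)
definition schreier_edges ::
  "'a set \<Rightarrow> ('a \<Rightarrow> 'g \<Rightarrow> 'a) \<Rightarrow> ('g, 'm) monoid_scheme \<Rightarrow> 'g set \<Rightarrow> ('a \<times> 'a) set" where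
  "schreier_edges X act G S =
    {(x, y). x \<in> X \<and> y \<in> X \<and> (\<exists>s \<in> S \<union> m_inv G ` S. y = act x s)}"

(* Length of a shortest edge path; meaningful only for x and y in the same connected
   component of the graph, where the minimum is over a non-empty set. *)
definition path_metric :: "('a \<times> 'a) set \<Rightarrow> 'a \<Rightarrow> 'a \<Rightarrow> real" where
  "path_metric E x y = real (LEAST n. (x, y) \<in> E ^^ n)"

definition inner_metric ::
  "'a set \<Rightarrow> ('a \<Rightarrow> 'a \<Rightarrow> 'a) \<Rightarrow> ('a \<Rightarrow> 'a) set \<Rightarrow> 'a \<Rightarrow> 'a \<Rightarrow> real" where
  "inner_metric X tri A =
    path_metric (schreier_edges X (\<lambda>x f. f x) (quandle_Inn X tri) A)"

definition displacement_metric ::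
  "'a set \<Rightarrow> ('a \<Rightarrow> 'a \<Rightarrow> 'a) \<Rightarrow> ('a \<Rightarrow> 'a) set \<Rightarrow> 'a \<Rightarrow> 'a \<Rightarrow> real" where
  "displacement_metric X tri U =
    path_metric (schreier_edges X (\<lambda>x f. f x) (quandle_Dis X tri) U)"

definition quasi_isometric ::
  "'a set \<Rightarrow> ('a \<Rightarrow> 'a \<Rightarrow> real) \<Rightarrow> 'b set \<Rightarrow> ('b \<Rightarrow> 'b \<Rightarrow> real) \<Rightarrow> bool" where
  "quasi_isometric M d N e \<longleftrightarrow>
    (\<exists>f L C. f \<in> M \<rightarrow> N \<and> L \<ge> 1 \<and> C \<ge> 0 \<and>
      (\<forall>x\<in>M. \<forall>y\<in>M. d x y / L - C \<le> e (f x) (f y) \<and> e (f x) (f y) \<le> L * d x y + C) \<and>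
      (\<forall>z\<in>N. \<exists>x\<in>M. e (f x) z \<le> C))"

lemma group_quandle_Aut:
  assumes "quandle X tri"
  shows "group (quandle_Aut X tri)"
proof -
  interpret quandle X tri by fact
  show ?thesis
  proof (rule groupI)
    fix f g assume f: "f \<in> carrier (quandle_Aut X tri)" and g: "g \<in> carrier (quandle_Aut X tri)"
    have "f \<in> X \<rightarrow> X" using f by (auto simp: quandle_Aut_def dest: Bij_imp_funcset)
    then show "f \<otimes>\<^bsub>quandle_Aut X tri\<^esub> g \<in> carrier (quandle_Aut X tri)"
      using f g by (simp add: quandle_Aut_def compose_Bij compose_eq Pi_iff closed)
  next
    show "\<one>\<^bsub>quandle_Aut X tri\<^esub> \<in> carrier (quandle_Aut X tri)"
      by (simp add: quandle_Aut_def id_Bij closed)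
  next
    fix f g h assume "f \<in> carrier (quandle_Aut X tri)" "g \<in> carrier (quandle_Aut X tri)"
      "h \<in> carrier (quandle_Aut X tri)"
    then show "f \<otimes>\<^bsub>quandle_Aut X tri\<^esub> g \<otimes>\<^bsub>quandle_Aut X tri\<^esub> h =
        f \<otimes>\<^bsub>quandle_Aut X tri\<^esub> (g \<otimes>\<^bsub>quandle_Aut X tri\<^esub> h)"
      by (simp add: quandle_Aut_def compose_assoc Bij_imp_funcset)
  next
    fix f assume "f \<in> carrier (quandle_Aut X tri)"
    then show "\<one>\<^bsub>quandle_Aut X tri\<^esub> \<otimes>\<^bsub>quandle_Aut X tri\<^esub> f = f"
      by (auto simp: quandle_Aut_def compose_def fun_eq_iff Bij_def extensional_def)
  next
    fix f assume f: "f \<in> carrier (quandle_Aut X tri)"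
    let ?g = "\<lambda>x\<in>X. inv_into X f x"
    have fB: "f \<in> Bij X" and bf: "bij_betw f X X" using f by (auto simp: quandle_Aut_def Bij_def)
    have fX: "f ` X = X" and inj: "inj_on f X" using bf by (auto simp: bij_betw_def)
    have gB: "?g \<in> Bij X" using fB by (rule restrict_inv_into_Bij)
    have "inv_into X f (tri x y) = tri (inv_into X f x) (inv_into X f y)"
      if "x \<in> X" "y \<in> X" for x y
    proof -
      have m: "inv_into X f x \<in> X" "inv_into X f y \<in> X"
        using that fX by (auto intro!: inv_into_into)
      then have "f (tri (inv_into X f x) (inv_into X f y)) = tri x y"
        using f that fX by (simp add: quandle_Aut_def f_inv_into_f)
      then show ?thesis using inj m closed by (metis inv_into_f_f)
    qed
    then have "?g \<in> carrier (quandle_Aut X tri)"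
      using gB by (simp add: quandle_Aut_def closed)
    moreover have "?g \<otimes>\<^bsub>quandle_Aut X tri\<^esub> f = \<one>\<^bsub>quandle_Aut X tri\<^esub>"
      using fX by (simp add: quandle_Aut_def compose_def fun_eq_iff f_inv_into_f)
    ultimately show "\<exists>g\<in>carrier (quandle_Aut X tri).
        g \<otimes>\<^bsub>quandle_Aut X tri\<^esub> f = \<one>\<^bsub>quandle_Aut X tri\<^esub>" by blast
  qed
qed

lemma point_sym_in_Aut:
  assumes "quandle X tri" and "y \<in> X"
  shows "point_sym X tri y \<in> carrier (quandle_Aut X tri)"
proof -
  interpret quandle X tri by fact
  show ?thesis
    using assms(2) bij[of y] self_distrib[OF _ _ assms(2)]
    by (simp only: quandle_Aut_def point_sym_def Bij_def)
       (simp add: closed cong: bij_betw_cong)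
qed

end

theory Submission
  imports Defs "HOL-Library.Product_Plus" "HOL-Library.Countable_Set" "HOL-Real_Asymp.Real_Asymp"
begin

text \<open>
  The example is an Alexander quandle. Let $\phi$ be the golden ratio and let $X = \mathbb{Z}[\phi]$
  with $x \triangleleft y = \phi^2 x - \phi y$; this is idempotent because $\phi^2 - \phi = 1$.
  As $\phi$ is a unit, the displacements $s_x s_y^{-1}$ are exactly the translations of
  $\mathbb{Z}[\phi]$. So Dis is $\mathbb{Z}^2$ acting simply transitively, $X$ is a single component,
  and every displacement metric is comparable to a word metric on $\mathbb{Z}^2$, in which balls grow
  quadratically.

  The inner group contains, besides the translations, the multiplication
  by $\phi^2$ (the point symmetry at $0$), a hyperbolic automorphism of $\mathbb{Z}^2$. Applying
  the point symmetries at $0$ and $-1$, that is $z \mapsto \phi^2 z$ and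
  $z \mapsto \phi^2 z + \phi$, in all $2^n$ orders to $0$ gives sums
  $\sum_i \epsilon_i \phi^{2i+1}$ with digits $0$ and $1$, which are pairwise different because
  distinct ones are at distance at least $1$ on the real line (\<open>horner_values_separated\<close>).
  Each symmetry is a word of bounded length in any generating set, so balls of the inner
  metric grow exponentially (\<open>inner_exponential_growth\<close>).

  Both Schreier graphs are connected, and that of the inner group has bounded degree. A
  quasi-isometry from the inner metric to the displacement metric would therefore have fibres of
  bounded size and would map the
  ball of radius $n$ into a ball of radius linear in $n$, so that $2^n$ would be bounded by a
  polynomial (\<open>not_quasi_isometric_growth\<close>).

  The quandle is built on an arbitrary set in bijection with $\mathbb{Z}^2$, so that no structure
  has to be transported to the natural numbers afterwards.
\<close>

section \<open>Path metrics and Schreier graphs\<close>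

lemma path_metric_le:
  assumes "(x, y) \<in> E ^^ n"
  shows "path_metric E x y \<le> real n"
  using assms unfolding path_metric_def by (simp add: Least_le)

text \<open>
  The metric is a least path length, hence carries information only when some path exists; this
  is the role of the exponent \<open>n\<close>.
\<close>
lemma path_metric_le_imp_relpow:
  assumes "(x, y) \<in> E ^^ n" and "path_metric E x y \<le> r"
  obtains m where "real m \<le> r" "(x, y) \<in> E ^^ m"
  using assms LeastI[of "\<lambda>n. (x, y) \<in> E ^^ n" n] unfolding path_metric_def by blast

text \<open>
  A word for \<open>g\<close> in the generators, read from any starting vertex, traces a path to the image of
  that vertex under \<open>g\<close>. The point is that its length does not depend on the vertex, so
  the conclusion speaks about one length for all of \<open>X\<close>.
\<close>
lemma generate_imp_uniform_path:
  fixes G :: "('g, 'm) monoid_scheme" (structure)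
  assumes S: "S \<subseteq> carrier G"
    and G: "group G"
    and closed: "\<And>x g. \<lbrakk>x \<in> X; g \<in> carrier G\<rbrakk> \<Longrightarrow> act x g \<in> X"
    and act_one: "\<And>x. x \<in> X \<Longrightarrow> act x \<one> = x"
    and mult: "\<And>x g h. \<lbrakk>x \<in> X; g \<in> carrier G; h \<in> carrier G\<rbrakk> \<Longrightarrow> act x (g \<otimes> h) = act (act x g) h"
    and g: "g \<in> generate G S"
  shows "\<exists>k. \<forall>x\<in>X. (x, act x g) \<in> schreier_edges X act G S ^^ k"
  using g
proof (induction rule: generate.induct)
  case one
  show ?case using act_one by (intro exI[of _ 0]) auto
next
  case (incl h)
  then show ?case using S closed by (intro exI[of _ 1]) (auto simp: schreier_edges_def)
next
  case (inv h)
  then show ?case using S closed G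
    by (intro exI[of _ 1]) (auto simp: schreier_edges_def group.inv_closed subset_iff)
next
  case (eng h1 h2)
  then obtain k l where
    k: "\<forall>x\<in>X. (x, act x h1) \<in> schreier_edges X act G S ^^ k" and
    l: "\<forall>x\<in>X. (x, act x h2) \<in> schreier_edges X act G S ^^ l"
    by blast
  have h: "h1 \<in> carrier G" "h2 \<in> carrier G"
    using eng.hyps group.generate_in_carrier[OF G S] by auto
  show ?case
  proof (intro exI ballI)
    fix x assume x: "x \<in> X"
    have "(x, act (act x h1) h2) \<in> schreier_edges X act G S ^^ (k + l)"
      unfolding relpow_add using k l x closed h by blast
    then show "(x, act x (h1 \<otimes> h2)) \<in> schreier_edges X act G S ^^ (k + l)"
      using mult x h by simp
  qed
qed

lemma relpow_Image_card_le:
  fixes E :: "('a \<times> 'a) set"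
  assumes "\<And>x. finite (E `` {x}) \<and> card (E `` {x}) \<le> D"
  shows "finite ((E ^^ n) `` {x}) \<and> card ((E ^^ n) `` {x}) \<le> D ^ n"
proof (induction n)
  case (Suc n)
  have eq: "(E ^^ Suc n) `` {x} = (\<Union>y\<in>(E ^^ n) `` {x}. E `` {y})" by auto
  have "card ((E ^^ Suc n) `` {x}) \<le> (\<Sum>y\<in>(E ^^ n) `` {x}. card (E `` {y}))"
    unfolding eq using Suc by (intro card_UN_le) auto
  also have "\<dots> \<le> card ((E ^^ n) `` {x}) * D"
    using sum_bounded_above[of "(E ^^ n) `` {x}" "\<lambda>y. card (E `` {y})" D] assms by simp
  also have "\<dots> \<le> D ^ Suc n" using Suc by simp
  finally show ?case unfolding eq using Suc assms by simp
qed simp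

text \<open>
  The degree is at most the number of generators and inverses, so the number of paths of bounded
  length has a bound that is uniform in the centre.
\<close>
lemma schreier_path_metric_ball_card_le:
  fixes r :: real
  assumes S: "finite S"
    and conn: "\<And>x y. \<lbrakk>x \<in> X; y \<in> X\<rbrakk> \<Longrightarrow> \<exists>n. (x, y) \<in> schreier_edges X act G S ^^ n"
  shows "\<exists>K. \<forall>x\<in>X. finite {y \<in> X. path_metric (schreier_edges X act G S) x y \<le> r} \<and>
    card {y \<in> X. path_metric (schreier_edges X act G S) x y \<le> r} \<le> K"
proof -
  let ?E = "schreier_edges X act G S"
  define D where "D = card (S \<union> m_inv G ` S)"
  have deg: "finite (?E `` {x}) \<and> card (?E `` {x}) \<le> D" for x
  proof -
    have sub: "?E `` {x} \<subseteq> act x ` (S \<union> m_inv G ` S)" by (auto simp: schreier_edges_def)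
    have fin: "finite (act x ` (S \<union> m_inv G ` S))" using S by simp
    have "card (?E `` {x}) \<le> card (act x ` (S \<union> m_inv G ` S))" by (rule card_mono[OF fin sub])
    also have "\<dots> \<le> D" unfolding D_def using S by (intro card_image_le) simp
    finally show ?thesis using finite_subset[OF sub fin] by simp
  qed
  define N where "N = nat \<lfloor>r\<rfloor>"
  show ?thesis
  proof (intro exI ballI)
    fix x assume x: "x \<in> X"
    have sub: "{y \<in> X. path_metric ?E x y \<le> r} \<subseteq> (\<Union>m\<in>{..N}. (?E ^^ m) `` {x})"
    proof
      fix y assume "y \<in> {y \<in> X. path_metric ?E x y \<le> r}"
      then have y: "y \<in> X" "path_metric ?E x y \<le> r" by auto
      obtain n where "(x, y) \<in> ?E ^^ n" using conn[OF x y(1)] by blast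
      then obtain m where m: "real m \<le> r" "(x, y) \<in> ?E ^^ m"
        using path_metric_le_imp_relpow y(2) by metis
      then have "m \<le> N" unfolding N_def by (simp add: le_nat_floor)
      then show "y \<in> (\<Union>m\<in>{..N}. (?E ^^ m) `` {x})" using m(2) by auto
    qed
    have fin: "finite (\<Union>m\<in>{..N}. (?E ^^ m) `` {x})"
      using relpow_Image_card_le[OF deg] by simp
    have "card {y \<in> X. path_metric ?E x y \<le> r} \<le> card (\<Union>m\<in>{..N}. (?E ^^ m) `` {x})"
      by (rule card_mono[OF fin sub])
    also have "\<dots> \<le> (\<Sum>m\<in>{..N}. card ((?E ^^ m) `` {x}))" by (rule card_UN_le) simp
    also have "\<dots> \<le> (\<Sum>m\<in>{..N}. D ^ m)"
      using relpow_Image_card_le[OF deg] by (intro sum_mono) blast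
    finally show "finite {y \<in> X. path_metric ?E x y \<le> r} \<and>
        card {y \<in> X. path_metric ?E x y \<le> r} \<le> (\<Sum>m\<in>{..N}. D ^ m)"
      using finite_subset[OF sub fin] by simp
  qed
qed

section \<open>Growth obstructs quasi-isometry\<close>

lemma polynomial_less_exponential:
  fixes a b K :: real
  assumes "a > 0" "b > 0"
  shows "\<exists>n::nat. K * (a * real n + b) ^ p < 2 ^ n"
proof -
  have "((\<lambda>n. (a * real n + b) ^ p / 2 ^ n) \<longlongrightarrow> 0) at_top"
    using assms by real_asymp
  then have "((\<lambda>n. K * ((a * real n + b) ^ p / 2 ^ n)) \<longlongrightarrow> K * 0) at_top"
    by (intro tendsto_intros)
  then have "eventually (\<lambda>n. K * ((a * real n + b) ^ p / 2 ^ n) < 1) at_top"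
    by (rule order_tendstoD) simp
  then show ?thesis by (auto simp: eventually_at_top_linorder field_simps)
qed

text \<open>
  Points with the same image under a quasi-isometry with constants \<open>L\<close> and \<open>C\<close> are at distance
  at most \<open>L * C\<close>, so its fibres have bounded size, while it enlarges radii at most linearly.
  Hence the number of points in a ball of the source is bounded by a constant times
  that in a ball of linearly larger radius of the target.
\<close>
lemma not_quasi_isometric_growth:
  fixes d :: "'a \<Rightarrow> 'a \<Rightarrow> real" and e :: "'b \<Rightarrow> 'b \<Rightarrow> real"
  assumes x0: "x0 \<in> M"
    and balls: "\<And>r. \<exists>K. \<forall>x\<in>M. finite {y \<in> M. d x y \<le> r} \<and> card {y \<in> M. d x y \<le> r} \<le> K"
    and exponential: "\<And>n::nat. \<exists>S\<subseteq>M. finite S \<and> 2 ^ n \<le> card S \<and> (\<forall>y\<in>S. d x0 y \<le> k * real n)"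
    and k: "k > 0"
    and refl: "\<And>z. z \<in> N \<Longrightarrow> e z z = 0"
    and polynomial: "\<And>z r. \<lbrakk>z \<in> N; 0 \<le> r\<rbrakk> \<Longrightarrow>
      finite {y \<in> N. e z y \<le> r} \<and> real (card {y \<in> N. e z y \<le> r}) \<le> (c * (r + 1)) ^ p"
    and c: "c > 0"
  shows "\<not> quasi_isometric M d N e"
proof
  assume "quasi_isometric M d N e"
  then obtain f L C where f: "f \<in> M \<rightarrow> N" and L: "L \<ge> 1" and C: "C \<ge> 0"
    and lower: "\<And>x y. \<lbrakk>x \<in> M; y \<in> M\<rbrakk> \<Longrightarrow> d x y / L - C \<le> e (f x) (f y)"
    and upper: "\<And>x y. \<lbrakk>x \<in> M; y \<in> M\<rbrakk> \<Longrightarrow> e (f x) (f y) \<le> L * d x y + C"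
    unfolding quasi_isometric_def by blast
  obtain K where K: "\<And>x. x \<in> M \<Longrightarrow> finite {y \<in> M. d x y \<le> L * C}"
      "\<And>x. x \<in> M \<Longrightarrow> card {y \<in> M. d x y \<le> L * C} \<le> K"
    using balls[of "L * C"] by blast
  obtain n :: nat where n: "real K * ((c * L * k) * real n + c * (C + 1)) ^ p < 2 ^ n"
    using polynomial_less_exponential[of "c * L * k" "c * (C + 1)" "real K" p] c k L C by auto
  obtain S where S: "S \<subseteq> M" "finite S" "2 ^ n \<le> card S" "\<And>y. y \<in> S \<Longrightarrow> d x0 y \<le> k * real n"
    using exponential[of n] by blast
  let ?B = "{z \<in> N. e (f x0) z \<le> L * (k * real n) + C}"
  have fibre: "card {y \<in> S. f y = f x} \<le> K" if x: "x \<in> S" for x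
  proof -
    have "{y \<in> S. f y = f x} \<subseteq> {y \<in> M. d x y \<le> L * C}"
    proof
      fix y assume "y \<in> {y \<in> S. f y = f x}"
      then have y: "y \<in> M" "f y = f x" using S(1) by auto
      have "d x y / L - C \<le> 0" using lower[of x y] refl[of "f x"] f x y S(1)
        by (metis Pi_iff subsetD)
      then show "y \<in> {y \<in> M. d x y \<le> L * C}" using y L by (simp add: field_simps)
    qed
    then show ?thesis using K[of x] x S(1) by (meson card_mono order_trans subsetD)
  qed
  have sub: "f ` S \<subseteq> ?B"
  proof
    fix z assume "z \<in> f ` S"
    then obtain y where y: "y \<in> S" "z = f y" by blast
    have "e (f x0) (f y) \<le> L * d x0 y + C" using upper x0 y S(1) by blast
    also have "\<dots> \<le> L * (k * real n) + C" using S(4) y L by (simp add: mult_left_mono)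
    finally show "z \<in> ?B" using y f S(1) by auto
  qed
  have B: "finite ?B" "real (card ?B) \<le> (c * (L * (k * real n) + C + 1)) ^ p"
    using polynomial[of "f x0" "L * (k * real n) + C"] f x0 L C k by (auto simp: Pi_iff)
  have "card S = card (\<Union>z\<in>f ` S. {y \<in> S. f y = z})" by (rule arg_cong[of _ _ card]) auto
  also have "\<dots> \<le> (\<Sum>z\<in>f ` S. card {y \<in> S. f y = z})" using S(2) by (intro card_UN_le) simp
  also have "\<dots> \<le> card (f ` S) * K"
    using sum_bounded_above[of "f ` S" "\<lambda>z. card {y \<in> S. f y = z}" K] fibre by auto
  also have "\<dots> \<le> card ?B * K" using card_mono[OF B(1) sub] by simp
  finally have "real (card S) \<le> real (card ?B) * real K" by (metis of_nat_le_iff of_nat_mult)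
  also have "\<dots> \<le> (c * (L * (k * real n) + C + 1)) ^ p * real K"
    using B(2) by (intro mult_right_mono) auto
  also have "\<dots> = real K * ((c * L * k) * real n + c * (C + 1)) ^ p"
    by (simp add: algebra_simps)
  also have "\<dots> < 2 ^ n" by (rule n)
  also have "\<dots> \<le> real (card S)" using S(3) by (metis of_nat_le_iff of_nat_numeral of_nat_power)
  finally show False by simp
qed

section \<open>Groups of quandle automorphisms\<close>

lemma finitely_generated_subgroup_generated:
  assumes G: "group G" and S: "finite S" "S \<subseteq> carrier (subgroup_generated G T)"
    and gen: "carrier (subgroup_generated G T) \<subseteq> generate G S"
  shows "finitely_generated_group (subgroup_generated G T)"
proof -
  interpret group G by fact
  let ?H = "carrier (subgroup_generated G T)"
  have H: "subgroup ?H G" by (rule subgroup_subgroup_generated)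
  have "generate (subgroup_generated G T) S = generate (G\<lparr>carrier := ?H\<rparr>) S"
    by (simp add: subgroup_generated_def)
  also have "\<dots> = generate G S" by (rule generate_consistent[OF S(2) H])
  also have "\<dots> = ?H" using generate_subgroup_incl[OF S(2) H] gen by blast
  finally show ?thesis using S unfolding finitely_generated_group_def generates_group_def by blast
qed

text \<open>
  The tautological action of a subgroup of the automorphism group; both the inner and the
  displacement group are instances.
\<close>
lemma quandle_uniform_path:
  assumes "quandle X tri"
    and S: "generates_group (subgroup_generated (quandle_Aut X tri) T) S"
    and g: "g \<in> carrier (subgroup_generated (quandle_Aut X tri) T)"
  shows "\<exists>k. \<forall>x\<in>X. (x, g x) \<in>
    schreier_edges X (\<lambda>x f. f x) (subgroup_generated (quandle_Aut X tri) T) S ^^ k"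
proof -
  interpret group "quandle_Aut X tri" by (rule group_quandle_Aut) fact
  let ?H = "subgroup_generated (quandle_Aut X tri) T"
  have car: "f \<in> Bij X" if "f \<in> carrier ?H" for f
    using that carrier_subgroup_generated_subset[of T] by (auto simp: quandle_Aut_def)
  show ?thesis
  proof (rule generate_imp_uniform_path)
    show "S \<subseteq> carrier ?H" "g \<in> generate ?H S" using S g by (auto simp: generates_group_def)
    show "group ?H" by simp
    show "f x \<in> X" if "x \<in> X" "f \<in> carrier ?H" for x f
      using car[OF that(2)] that(1) Bij_imp_funcset by blast
    show "\<one>\<^bsub>?H\<^esub> x = x" if "x \<in> X" for x
      using that by (simp add: quandle_Aut_def)
    show "(f \<otimes>\<^bsub>?H\<^esub> h) x = h (f x)" if "x \<in> X" for x f h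
      using that by (simp add: quandle_Aut_def compose_def)
  qed
qed

section \<open>The ring of integers of the golden field\<close>

text \<open>
  A pair \<open>(a, b)\<close> stands for the number $a + b \phi$ of $\mathbb{Z}[\phi]$, where
  $\phi^2 = \phi + 1$, and \<open>phi\<close> is the multiplication by $\phi$.
\<close>
definition phi :: "int \<times> int \<Rightarrow> int \<times> int" where
  "phi z = (snd z, fst z + snd z)"

definition phi_inv :: "int \<times> int \<Rightarrow> int \<times> int" where
  "phi_inv z = (snd z - fst z, fst z)"

lemma phi_phi_inv [simp]: "phi (phi_inv z) = z" and phi_inv_phi [simp]: "phi_inv (phi z) = z"
  by (simp_all add: phi_def phi_inv_def)

lemma phi_eq_iff [simp]: "phi v = phi w \<longleftrightarrow> v = w"
  by (metis phi_inv_phi)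

lemma phi_zero [simp]: "phi 0 = 0" and phi_add: "phi (v + w) = phi v + phi w" and phi_diff: "phi (v - w) = phi v - phi w"
  by (simp_all add: phi_def prod_eq_iff)

text \<open>
  Applied to the quandle operation $\phi^2 x - \phi y$, this identity gives both idempotence
  and self-distributivity.
\<close>
lemma phi_phi: "phi (phi z) = phi z + z"
  by (simp add: phi_def prod_eq_iff)

definition golden :: real where "golden = (1 + sqrt 5) / 2"

lemma golden_squared: "golden * golden = golden + 1"
  by (simp add: golden_def field_simps)

lemma golden_ge_1: "golden \<ge> 1"
proof -
  have "sqrt 5 \<ge> sqrt 1" by (intro real_sqrt_le_mono) simp
  then show ?thesis by (simp add: golden_def)
qed

text \<open>
  One of the two real embeddings of $\mathbb{Z}[\phi]$, the one under which multiplication by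
  $\phi^2$ is expanding.
\<close>
definition golden_embed :: "int \<times> int \<Rightarrow> real" where
  "golden_embed z = of_int (fst z) + of_int (snd z) * golden"

lemma golden_embed_add: "golden_embed (v + w) = golden_embed v + golden_embed w"
  by (simp add: golden_embed_def algebra_simps)

lemma golden_embed_phi: "golden_embed (phi z) = golden * golden_embed z"
proof -
  have "golden * golden_embed z = golden * of_int (fst z) + (golden * golden) * of_int (snd z)"
    by (simp add: golden_embed_def algebra_simps)
  then show ?thesis unfolding golden_squared by (simp add: golden_embed_def phi_def algebra_simps)
qed

section \<open>Exponentially many sums of odd powers of the golden ratio\<close>

text \<open>
  These are the sums $\sum_{i<n} \epsilon_i \phi^{2i+1}$ with $\epsilon_i \in \{0, 1\}$, arranged
  as in the Horner scheme so that each step is a point symmetry of the quandle.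
\<close>
fun horner_values :: "nat \<Rightarrow> (int \<times> int) set" where
  "horner_values 0 = {0}"
| "horner_values (Suc n) =
    (\<lambda>z. phi (phi z)) ` horner_values n \<union> (\<lambda>z. phi (phi z) + phi (1, 0)) ` horner_values n"

lemma horner_values_SucE:
  assumes "z \<in> horner_values (Suc n)"
  obtains w a where "w \<in> horner_values n" "a = 0 \<or> a = phi (1, 0)" "z = phi (phi w) + a"
proof -
  have "\<exists>w\<in>horner_values n. \<exists>a\<in>{0, phi (1, 0)}. z = phi (phi w) + a"
    using assms by auto
  then show ?thesis using that by blast
qed

lemma golden_embed_phi_one: "golden_embed (phi (1, 0)) = golden"
  by (simp add: golden_embed_phi) (simp add: golden_embed_def)

text \<open>
  The constant $1$ reproduces itself: $\phi^2 \cdot 1 - \phi = 1$.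
\<close>
lemma golden_expansion:
  assumes "\<bar>t\<bar> \<ge> 1" "\<bar>s\<bar> \<le> golden"
  shows "\<bar>golden * (golden * t) + s\<bar> \<ge> 1"
proof -
  have "golden + 1 \<le> (golden + 1) * \<bar>t\<bar>" using assms(1) golden_ge_1 by simp
  also have "\<dots> = \<bar>golden * (golden * t)\<bar>"
    using golden_ge_1 by (simp add: abs_mult mult.assoc[symmetric] golden_squared)
  finally show ?thesis using assms(2) by linarith
qed

text \<open>
  If the leading parts differ, their distance survives the expansion and the last digit by
  \<open>golden_expansion\<close>; if they agree, the last digits differ and contribute \<open>golden\<close>.
\<close>
lemma horner_values_separated:
  assumes "u \<in> horner_values n" "v \<in> horner_values n" "u \<noteq> v"
  shows "\<bar>golden_embed u - golden_embed v\<bar> \<ge> 1"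
  using assms
proof (induction n arbitrary: u v)
  case (Suc n)
  obtain u' a where u: "u' \<in> horner_values n" "u = phi (phi u') + a" "a = 0 \<or> a = phi (1, 0)"
    using Suc.prems(1) by (rule horner_values_SucE)
  obtain v' b where v: "v' \<in> horner_values n" "v = phi (phi v') + b" "b = 0 \<or> b = phi (1, 0)"
    using Suc.prems(2) by (rule horner_values_SucE)
  let ?s = "golden_embed a - golden_embed b"
  have emb0: "golden_embed 0 = 0" by (simp add: golden_embed_def)
  have s: "\<bar>?s\<bar> \<le> golden"
    using u(3) v(3) golden_ge_1 by (auto simp: golden_embed_phi_one emb0)
  have diff: "golden_embed u - golden_embed v =
      golden * (golden * (golden_embed u' - golden_embed v')) + ?s"
    by (simp add: u(2) v(2) golden_embed_add golden_embed_phi algebra_simps)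
  show ?case
  proof (cases "u' = v'")
    case True
    then have "a \<noteq> b" using Suc.prems(3) u v by auto
    then have "\<bar>?s\<bar> = golden"
      using u(3) v(3) golden_ge_1 by (auto simp: golden_embed_phi_one emb0)
    then show ?thesis using diff True golden_ge_1 by simp
  next
    case False
    then show ?thesis unfolding diff using Suc.IH u v s by (intro golden_expansion) auto
  qed
qed simp

text \<open>
  The two images of the set under the maps of a Horner step are disjoint: at a
  common point $\phi^2 u = \phi^2 v + \phi$ one has $u \neq v$, hence $u$ and $v$ are at distance at
  least $1$, and then $\phi^2 (u - v) - \phi$ has absolute value at least $1$ as well.
\<close>
lemma card_horner_values: "finite (horner_values n) \<and> card (horner_values n) = 2 ^ n"
proof (induction n)
  case (Suc n)
  let ?f = "\<lambda>z. phi (phi z)" and ?g = "\<lambda>z. phi (phi z) + phi (1, 0)"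
  have inj: "inj_on ?f (horner_values n)" "inj_on ?g (horner_values n)"
    by (simp_all add: inj_on_def)
  have "?f u \<noteq> ?g v" if "u \<in> horner_values n" "v \<in> horner_values n" for u v
  proof
    assume eq: "?f u = ?g v"
    have uv: "golden * (golden * (golden_embed u - golden_embed v)) + (- golden) = 0"
      using arg_cong[OF eq, of golden_embed]
      by (simp add: golden_embed_add golden_embed_phi golden_embed_phi_one algebra_simps)
        (simp add: golden_embed_def)
    show False
    proof (cases "u = v")
      case True
      then show ?thesis using uv golden_ge_1 by simp
    next
      case False
      then show ?thesis
        using golden_expansion[of "golden_embed u - golden_embed v" "- golden"]
          horner_values_separated[OF that] uv golden_ge_1 by simp
    qed
  qed
  then have disj: "?f ` horner_values n \<inter> ?g ` horner_values n = {}" by blast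
  show ?case using Suc by (simp add: card_Un_disjoint disj card_image inj)
qed simp

section \<open>The golden quandle\<close>

text \<open>
  The underlying set is any type that \<open>dec\<close> identifies with $\mathbb{Z}[\phi]$.
\<close>
locale golden_quandle =
  fixes dec :: "'a \<Rightarrow> int \<times> int"
  assumes bij_dec: "bij dec"
begin

definition enc :: "int \<times> int \<Rightarrow> 'a" where "enc = inv_into UNIV dec"

lemma dec_enc [simp]: "dec (enc z) = z" and enc_dec [simp]: "enc (dec x) = x"
  using bij_dec by (simp_all add: enc_def bij_is_surj surj_f_inv_f bij_is_inj)

definition tri :: "'a \<Rightarrow> 'a \<Rightarrow> 'a" where
  "tri x y = enc (phi (phi (dec x)) - phi (dec y))"

definition translate :: "int \<times> int \<Rightarrow> 'a \<Rightarrow> 'a" where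
  "translate w x = enc (dec x + w)"

abbreviation "Aut \<equiv> quandle_Aut UNIV tri"
abbreviation "Inn \<equiv> quandle_Inn UNIV tri"
abbreviation "Dis \<equiv> quandle_Dis UNIV tri"
abbreviation "psym \<equiv> point_sym UNIV tri"

lemma quandle: "quandle UNIV tri"
proof
  show "tri x x = x" for x by (simp add: tri_def phi_phi)
  show "bij_betw (\<lambda>x. tri x y) UNIV UNIV" for y
    by (rule bij_betw_byWitness[where f' = "\<lambda>x. enc (phi_inv (phi_inv (dec x + phi (dec y))))"])
      (simp_all add: tri_def)
  show "tri (tri x y) z = tri (tri x z) (tri y z)" for x y z
    by (simp add: tri_def phi_add phi_diff phi_phi algebra_simps)
qed simp_all

sublocale Aut: group Aut
  using group_quandle_Aut[OF quandle] .

lemma sym_apply [simp]: "psym y x = tri x y"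
  by (simp add: point_sym_def)

lemma sym_in_Aut [simp]: "psym y \<in> carrier Aut"
  using point_sym_in_Aut[OF quandle] by simp

lemma Aut_mult [simp]: "(f \<otimes>\<^bsub>Aut\<^esub> g) x = g (f x)"
  by (simp add: quandle_Aut_def compose_def)

lemma Aut_one: "\<one>\<^bsub>Aut\<^esub> = (\<lambda>x. x)"
  by (simp add: quandle_Aut_def restrict_UNIV)

lemma translate_in_Aut [simp]: "translate w \<in> carrier Aut"
proof -
  have "bij (translate w)"
    by (rule bij_betw_byWitness[where f' = "translate (- w)"]) (simp_all add: translate_def)
  moreover have "translate w (tri x y) = tri (translate w x) (translate w y)" for x y
    by (simp add: translate_def tri_def phi_add phi_phi algebra_simps)
  ultimately show ?thesis by (simp add: quandle_Aut_def Bij_def)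
qed

lemma translate_mult: "translate v \<otimes>\<^bsub>Aut\<^esub> translate w = translate (v + w)"
  by (rule ext) (simp add: translate_def add.assoc)

lemma translate_0: "translate 0 = \<one>\<^bsub>Aut\<^esub>"
  by (rule ext) (simp add: translate_def Aut_one)

lemma inv_translate: "inv\<^bsub>Aut\<^esub> (translate w) = translate (- w)"
  by (rule Aut.inv_equality) (simp_all add: translate_mult translate_0)

lemma subgroup_translations: "subgroup (range translate) Aut"
  by (rule Aut.subgroupI) (auto simp: inv_translate translate_mult)

text \<open>
  Both finite generation statements reduce to this one, the displacement group being
  the group of translations and the inner group being generated by it and a single
  point symmetry.
\<close>
lemma translations_generated:
  "range translate \<subseteq> generate Aut {translate (1, 0), translate (0, 1)}"
proof -
  let ?H = "generate Aut {translate (1, 0), translate (0, 1)}"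
  interpret H: subgroup ?H Aut by (rule Aut.generate_is_subgroup) auto
  have neg: "translate (- w) \<in> ?H" if "translate w \<in> ?H" for w
    using H.m_inv_closed[OF that] by (simp add: inv_translate)
  have plus: "translate (v + w) \<in> ?H" if "translate v \<in> ?H" "translate w \<in> ?H" for v w
    using H.m_closed[OF that] by (simp add: translate_mult)
  have base: "translate (1, 0) \<in> ?H" "translate (0, 1) \<in> ?H" by (auto intro: generate.incl)
  have zero: "translate (0, 0) \<in> ?H"
    using H.one_closed translate_0 by (simp add: zero_prod_def)
  have 1: "translate (a, 0) \<in> ?H" for a
  proof (induction a rule: int_induct[where k = 0])
    case (step1 i) then show ?case using plus[OF _ base(1), of "(i, 0)"] by simp
  next
    case (step2 i) then show ?case using plus[OF _ neg[OF base(1)], of "(i, 0)"] by simp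
  qed (rule zero)
  have 2: "translate (0, b) \<in> ?H" for b
  proof (induction b rule: int_induct[where k = 0])
    case (step1 i) then show ?case using plus[OF _ base(2), of "(0, i)"] by simp
  next
    case (step2 i) then show ?case using plus[OF _ neg[OF base(2)], of "(0, i)"] by simp
  qed (rule zero)
  have "translate (a, b) \<in> ?H" for a b using plus[OF 1 2, of a b] by simp
  then show ?thesis by auto
qed

text \<open>
  Precomposing the point symmetry at $y$ with the translation by $w$ adds $\phi^2 w$, which is the
  effect of replacing $y$ by $y - \phi w$. Since $\phi$ is a unit, every pair of point
  symmetries is related in this way by a translation.
\<close>
lemma translate_mult_sym: "translate w \<otimes>\<^bsub>Aut\<^esub> psym y = psym (enc (dec y - phi w))"
  by (rule ext) (simp add: translate_def tri_def phi_add phi_diff algebra_simps)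

lemma sym_mult_inv_sym:
  "psym x \<otimes>\<^bsub>Aut\<^esub> inv\<^bsub>Aut\<^esub> (psym y) = translate (phi_inv (dec y - dec x))"
proof -
  have "psym x = translate (phi_inv (dec y - dec x)) \<otimes>\<^bsub>Aut\<^esub> psym y"
    by (simp add: translate_mult_sym)
  then show ?thesis by (simp add: Aut.m_assoc)
qed

lemma displacements_eq:
  "{psym x \<otimes>\<^bsub>Aut\<^esub> inv\<^bsub>Aut\<^esub> (psym y) | x y. x \<in> UNIV \<and> y \<in> UNIV} = range translate"
proof
  show "range translate \<subseteq> {psym x \<otimes>\<^bsub>Aut\<^esub> inv\<^bsub>Aut\<^esub> (psym y) | x y. x \<in> UNIV \<and> y \<in> UNIV}"
  proof clarify
    fix w
    have "psym (enc 0) \<otimes>\<^bsub>Aut\<^esub> inv\<^bsub>Aut\<^esub> (psym (enc (phi w))) = translate w"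
      by (simp add: sym_mult_inv_sym)
    then show "\<exists>x y. translate w = psym x \<otimes>\<^bsub>Aut\<^esub> inv\<^bsub>Aut\<^esub> (psym y) \<and> x \<in> UNIV \<and> y \<in> UNIV"
      by (metis UNIV_I)
  qed
qed (auto simp: sym_mult_inv_sym)

lemma carrier_Dis: "carrier Dis = range translate"
proof -
  have "carrier Dis = generate Aut (range translate)"
    unfolding quandle_Dis_def displacements_eq
    by (simp add: carrier_subgroup_generated Int_absorb1 image_subset_iff)
  also have "\<dots> = range translate"
    using Aut.generate_subgroup_incl[OF order_refl subgroup_translations]
    by (auto intro: generate.incl)
  finally show ?thesis .
qed

lemma carrier_Inn: "carrier Inn = generate Aut (range psym)"
  by (simp add: quandle_Inn_def carrier_subgroup_generated Int_absorb1 image_subset_iff)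

lemma sym_in_Inn: "psym y \<in> carrier Inn"
  by (auto simp: carrier_Inn intro: generate.incl)

lemma translate_in_Inn: "translate w \<in> carrier Inn"
proof -
  have "psym (enc 0) \<otimes>\<^bsub>Aut\<^esub> inv\<^bsub>Aut\<^esub> (psym (enc (phi w))) = translate w"
    by (simp add: sym_mult_inv_sym)
  then show ?thesis unfolding carrier_Inn by (metis generate.eng generate.incl generate.inv rangeI)
qed

lemma finitely_generated_Dis: "finitely_generated_group Dis"
  unfolding quandle_Dis_def
proof (rule finitely_generated_subgroup_generated[OF Aut.is_group])
  show "finite {translate (1, 0), translate (0, 1)}" by simp
qed (use carrier_Dis translations_generated in \<open>auto simp: quandle_Dis_def\<close>)

lemma finitely_generated_Inn: "finitely_generated_group Inn"
proof -
  let ?S = "{psym (enc 0), translate (1, 0), translate (0, 1)}"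
  have S: "?S \<subseteq> carrier Inn" using sym_in_Inn translate_in_Inn by auto
  have tr: "range translate \<subseteq> generate Aut ?S"
    using translations_generated Aut.mono_generate[of "{translate (1, 0), translate (0, 1)}" ?S]
    by blast
  have "psym y \<in> generate Aut ?S" for y
  proof -
    have "psym y = translate (- phi_inv (dec y)) \<otimes>\<^bsub>Aut\<^esub> psym (enc 0)"
      by (rule ext) (simp add: translate_def tri_def phi_diff phi_add algebra_simps)
    then show ?thesis using tr by (metis generate.eng generate.incl insertI1 range_subsetD)
  qed
  then have "carrier Inn \<subseteq> generate Aut ?S"
    unfolding carrier_Inn by (intro Aut.generate_subgroup_incl Aut.generate_is_subgroup) auto
  then show ?thesis
    using S unfolding quandle_Inn_def
    by (intro finitely_generated_subgroup_generated[OF Aut.is_group, of ?S]) auto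
qed

lemma translate_transitive: "\<exists>w. translate w x = y"
  by (rule exI[of _ "dec y - dec x"]) (simp add: translate_def)

lemma UNIV_component: "UNIV \<in> quandle_components UNIV tri"
proof -
  have "orbit Inn (\<lambda>f. f) x = UNIV" for x
    unfolding orbit_def using translate_transitive[of x] translate_in_Inn by auto metis
  then show ?thesis unfolding quandle_components_def orbits_def by auto
qed

text \<open>
  An edge moves a point by one of finitely many vectors, all with coordinates bounded by some \<open>R\<close>.
  A path of length $m$ thus stays in a square of side $2Rm + 1$ around its start.
\<close>
lemma displacement_ball_card_le:
  assumes U: "finite U" "generates_group Dis U"
  shows "\<exists>c>0. \<forall>z r. 0 \<le> r \<longrightarrow> finite {y. displacement_metric UNIV tri U z y \<le> r} \<and>
    real (card {y. displacement_metric UNIV tri U z y \<le> r}) \<le> (c * (r + 1)) ^ 2"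
proof -
  let ?E = "schreier_edges UNIV (\<lambda>x f. f x) Dis U"
  have Dis: "group Dis" unfolding quandle_Dis_def by simp
  have "U \<union> m_inv Dis ` U \<subseteq> range translate"
    using U(2) group.inv_closed[OF Dis] by (auto simp: generates_group_def carrier_Dis)
  then obtain W where W: "finite W" "U \<union> m_inv Dis ` U = translate ` W"
    using U(1) by (meson finite_UnI finite_imageI finite_subset_image)
  define R where "R = (\<Sum>w\<in>W. \<bar>fst w\<bar> + \<bar>snd w\<bar>)"
  have R0: "R \<ge> 0" unfolding R_def by (intro sum_nonneg) simp
  have R: "\<bar>fst w\<bar> \<le> R \<and> \<bar>snd w\<bar> \<le> R" if "w \<in> W" for w
    using member_le_sum[of w W "\<lambda>w. \<bar>fst w\<bar> + \<bar>snd w\<bar>"] that W(1) unfolding R_def by fastforce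
  have path: "\<bar>fst (dec y) - fst (dec x)\<bar> \<le> R * int n \<and> \<bar>snd (dec y) - snd (dec x)\<bar> \<le> R * int n"
    if "(x, y) \<in> ?E ^^ n" for x y n
    using that
  proof (induction n arbitrary: y)
    case (Suc n)
    then obtain t where t: "(x, t) \<in> ?E ^^ n" "(t, y) \<in> ?E" by auto
    then obtain w where "w \<in> W" "y = translate w t"
      using W(2) by (auto simp: schreier_edges_def)
    then show ?case using Suc.IH[OF t(1)] R[of w]
      by (auto simp: translate_def algebra_simps abs_le_iff)
  qed simp
  have conn: "\<exists>n. (x, y) \<in> ?E ^^ n" for x y
  proof -
    obtain w where w: "translate w x = y" using translate_transitive by blast
    obtain k where "\<forall>x\<in>UNIV. (x, translate w x) \<in> ?E ^^ k"
      using quandle_uniform_path[OF quandle U(2)[unfolded quandle_Dis_def], of "translate w"] carrier_Dis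
      unfolding quandle_Dis_def by blast
    then show ?thesis using w by blast
  qed
  have "finite {y. displacement_metric UNIV tri U z y \<le> r} \<and>
      real (card {y. displacement_metric UNIV tri U z y \<le> r}) \<le> ((2 * of_int R + 1) * (r + 1)) ^ 2"
    (is "finite ?B \<and> _") if r: "0 \<le> r" for z and r :: real
  proof -
    define b where "b = R * \<lfloor>r\<rfloor>"
    have b0: "b \<ge> 0" unfolding b_def using R0 r by simp
    let ?Q = "{fst (dec z) - b..fst (dec z) + b} \<times> {snd (dec z) - b..snd (dec z) + b}"
    have sub: "?B \<subseteq> enc ` ?Q"
    proof
      fix y assume "y \<in> ?B"
      then have "path_metric ?E z y \<le> r" by (simp add: displacement_metric_def)
      then obtain m where m: "real m \<le> r" "(z, y) \<in> ?E ^^ m"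
        using path_metric_le_imp_relpow conn[of z y] by metis
      then have "int m \<le> \<lfloor>r\<rfloor>" by (simp add: le_floor_iff)
      then have "R * int m \<le> b" unfolding b_def using R0 by (intro mult_left_mono)
      then have "dec y \<in> ?Q" using path[OF m(2)] by (auto simp: mem_Times_iff abs_le_iff)
      then show "y \<in> enc ` ?Q" by (metis enc_dec imageI)
    qed
    have "card ?B \<le> card ?Q"
      using card_mono[OF _ sub] card_image_le[of ?Q enc]
      by (meson finite_SigmaI finite_atLeastAtMost_int finite_imageI order_trans)
    also have "\<dots> = nat (2 * b + 1) ^ 2"
      by (simp add: card_cartesian_product power2_eq_square algebra_simps)
    finally have "real (card ?B) \<le> real (nat (2 * b + 1) ^ 2)" by (simp only: of_nat_le_iff)
    also have "\<dots> = (2 * of_int b + 1) ^ 2" using b0 by simp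
    also have "\<dots> \<le> ((2 * of_int R + 1) * (r + 1)) ^ 2"
    proof (rule power_mono)
      have "of_int b \<le> of_int R * r" unfolding b_def using R0 by (simp add: mult_left_mono)
      then show "2 * of_int b + 1 \<le> (2 * of_int R + 1) * (r + 1)" using R0 r by (simp add: algebra_simps)
    qed (use b0 in simp)
    finally show ?thesis using finite_subset[OF sub] by simp
  qed
  then show ?thesis using R0 by (intro exI[of _ "2 * real_of_int R + 1"]) auto
qed

text \<open>
  The two point symmetries that realise the Horner step are paths of fixed lengths
  \<open>k\<close> and \<open>l\<close>, whatever the generating set, so all Horner values of order $n$ lie within distance
  $(k + l) n$ of the origin.
\<close>
lemma inner_exponential_growth:
  assumes A: "generates_group Inn A"
  shows "\<exists>k>0. \<forall>n. \<exists>S. finite S \<and> 2 ^ n \<le> card S \<and>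
    (\<forall>y\<in>S. inner_metric UNIV tri A (enc 0) y \<le> k * real n)"
proof -
  let ?E = "schreier_edges UNIV (\<lambda>x f. f x) Inn A"
  obtain k where k: "\<And>x. (x, psym (enc 0) x) \<in> ?E ^^ k"
    using quandle_uniform_path[OF quandle A[unfolded quandle_Inn_def], of "psym (enc 0)"] sym_in_Inn
    unfolding quandle_Inn_def by blast
  \<comment> \<open>With centre $-1$ the term $-\phi y$ of the operation is the digit $\phi$.\<close>
  obtain l where l: "\<And>x. (x, psym (enc (- 1, 0)) x) \<in> ?E ^^ l"
    using quandle_uniform_path[OF quandle A[unfolded quandle_Inn_def], of "psym (enc (- 1, 0))"]
      sym_in_Inn
    unfolding quandle_Inn_def by blast
  have sym0: "psym (enc 0) (enc z) = enc (phi (phi z))"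
    and sym1: "psym (enc (- 1, 0)) (enc z) = enc (phi (phi z) + phi (1, 0))" for z
    by (simp_all add: tri_def) (simp_all add: phi_def prod_eq_iff)
  have path: "\<exists>m\<le>(k + l) * n. (enc 0, enc z) \<in> ?E ^^ m" if "z \<in> horner_values n" for n z
    using that
  proof (induction n arbitrary: z)
    case (Suc n)
    then obtain z' where z': "z' \<in> horner_values n"
      "enc z = psym (enc 0) (enc z') \<or> enc z = psym (enc (- 1, 0)) (enc z')"
      unfolding sym0 sym1 by auto
    obtain m where m: "m \<le> (k + l) * n" "(enc 0, enc z') \<in> ?E ^^ m" using Suc.IH z'(1) by blast
    obtain j where j: "j \<le> k + l" "(enc z', enc z) \<in> ?E ^^ j"
      using z'(2) k l by (metis le_add1 le_add2)
    have "(enc 0, enc z) \<in> ?E ^^ (m + j)" unfolding relpow_add using m(2) j(2) by blast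
    then show ?case using m(1) j(1) by (intro exI[of _ "m + j"]) simp
  qed auto
  show ?thesis
  proof (intro exI conjI allI ballI)
    fix n
    show "finite (enc ` horner_values n)" using card_horner_values by simp
    have "inj enc" by (metis dec_enc injI)
    then show "2 ^ n \<le> card (enc ` horner_values n)"
      using card_horner_values by (simp add: card_image inj_on_subset)
    fix y assume "y \<in> enc ` horner_values n"
    then obtain m where m: "m \<le> (k + l) * n" "(enc 0, y) \<in> ?E ^^ m" using path by blast
    have "inner_metric UNIV tri A (enc 0) y \<le> real m"
      unfolding inner_metric_def using m(2) by (rule path_metric_le)
    also have "\<dots> \<le> real ((k + l) * n)" using m(1) by (rule of_nat_mono)
    also have "\<dots> \<le> real (k + l + 1) * real n" by (simp add: algebra_simps)
    \<comment> \<open>The summand $1$ makes the rate positive even if both words are empty.\<close>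
    finally show "inner_metric UNIV tri A (enc 0) y \<le> real (k + l + 1) * real n" .
  qed simp
qed

lemma inner_connected:
  assumes A: "generates_group Inn A"
  shows "\<exists>n. (x, y) \<in> schreier_edges UNIV (\<lambda>x f. f x) Inn A ^^ n"
proof -
  obtain w where w: "translate w x = y" using translate_transitive by blast
  obtain k where "\<forall>x\<in>UNIV. (x, translate w x) \<in> schreier_edges UNIV (\<lambda>x f. f x) Inn A ^^ k"
    using quandle_uniform_path[OF quandle A[unfolded quandle_Inn_def], of "translate w"] translate_in_Inn
    unfolding quandle_Inn_def by blast
  then show ?thesis using w by blast
qed

lemma not_quasi_isometric:
  assumes A: "finite A" "generates_group Inn A" and U: "finite U" "generates_group Dis U"
  shows "\<not> quasi_isometric UNIV (inner_metric UNIV tri A) UNIV (displacement_metric UNIV tri U)"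
proof -
  obtain c where c: "c > 0" "\<And>z r. 0 \<le> r \<Longrightarrow> finite {y. displacement_metric UNIV tri U z y \<le> r} \<and>
      real (card {y. displacement_metric UNIV tri U z y \<le> r}) \<le> (c * (r + 1)) ^ 2"
    using displacement_ball_card_le[OF U] by blast
  obtain k where k: "k > 0" "\<And>n::nat. \<exists>S. finite S \<and> 2 ^ n \<le> card S \<and>
      (\<forall>y\<in>S. inner_metric UNIV tri A (enc 0) y \<le> k * real n)"
    using inner_exponential_growth[OF A(2)] by blast
  show ?thesis
  proof (rule not_quasi_isometric_growth[where ?x0.0 = "enc 0" and k = k and c = c and p = 2])
    show "\<exists>K. \<forall>x\<in>UNIV. finite {y \<in> UNIV. inner_metric UNIV tri A x y \<le> r} \<and>
        card {y \<in> UNIV. inner_metric UNIV tri A x y \<le> r} \<le> K" for r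
      unfolding inner_metric_def
      by (rule schreier_path_metric_ball_card_le[OF A(1) inner_connected[OF A(2)]])
    show "displacement_metric UNIV tri U z z = 0" for z
      by (simp add: displacement_metric_def path_metric_def)
  qed (use c k in auto)
qed

end

theorem theorem1p3:
  shows "\<exists>(X :: nat set) (tri :: nat \<Rightarrow> nat \<Rightarrow> nat) (C :: nat set).
    quandle X tri \<and> C \<in> quandle_components X tri \<and>
    finitely_generated_group (quandle_Inn X tri) \<and>
    finitely_generated_group (quandle_Dis X tri) \<and>
    (\<forall>A U. finite A \<and> generates_group (quandle_Inn X tri) A \<and>
           finite U \<and> generates_group (quandle_Dis X tri) U \<longrightarrow>
       \<not> quasi_isometric C (inner_metric X tri A) C (displacement_metric X tri U))"
proof -
  have "bij (from_nat_into (UNIV :: (int \<times> int) set))"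
    by (rule bij_betw_from_nat_into) (simp_all add: finite_prod)
  then interpret golden_quandle "from_nat_into (UNIV :: (int \<times> int) set)"
    by unfold_locales
  show ?thesis
    using quandle UNIV_component finitely_generated_Inn finitely_generated_Dis not_quasi_isometric
    by (intro exI[of _ UNIV] exI[of _ tri]) blast
qed

end
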